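(* The category $\mathfrak{R}$ of finite-dimensional rotational representations of $\mathbb{R}\langle X,Y\rangle$ has the Krull-Schmidt property: if $(\delta,\epsilon)\in\mathfrak{R}$, and $(\delta,\epsilon)=(\sigma_1,\tau_1)\oplus\cdots\oplus(\sigma_k,\tau_k)$ and $(\delta,\epsilon)=(\sigma'_1,\tau'_1)\oplus\cdots\oplus(\sigma'_l,\tau'_l)$ are decompositions of $(\delta,\epsilon)$ into irreducible subrepresentations, then $k=l$ and there exists a permutation $f\in S_k$ such that $(\sigma_{f(i)},\tau_{f(i)})$ is isomorphic in $\mathfrak{R}$ to $(\sigma'_i,\tau'_i)$ for all $i\leqslant k$.
   Context: A rotation in a Euclidean space $V=(V,\langle\,,\rangle)$ is an orthogonal endomorphism $\delta\in O(V)$ such that (1) $\delta^2(v)\in\operatorname{span}\{v,\delta(v)\}$ and (2) $\langle v,\delta(v)\rangle=\langle w,\delta(w)\rangle$ for all unit vectors $v,w\in V$. A pair $(\sigma,\tau)$ of linear endomorphisms of a real vector space $V$ is identified with the representation $\mathbb{R}\langle X,Y\rangle\to\operatorname{End}(V)$, $X\mapsto\sigma$, $Y\mapsto\tau$, of the free associative algebra $\mathbb{R}\langle X,Y\rangle$. The category of finite-dimensional representations is denoted $\operatorname{rep}_f(\mathbb{R}\langle X,Y\rangle)$. If $V$ is Euclidean and $\delta,\epsilon$ are rotations in $V$, the representation $(\delta,\epsilon)$ is called rotational. $\mathfrak{R}$ is the (non-full) subcategory of $\operatorname{rep}_f(\mathbb{R}\langle X,Y\rangle)$ whose objects are the finite-dimensional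 rotational representations; a morphism from $(\delta,\epsilon)$ in $V$ to $(\sigma,\tau)$ in $W$ is a morphism of representations $\varphi:V\to W$ (i.e. a linear map with $\varphi\delta=\sigma\varphi$, $\varphi\epsilon=\tau\varphi$) which decomposes as $\varphi=\psi\oplus 0:U\oplus\ker\varphi\to W$, where $U=(\ker\varphi)^\perp\subset V$ and $\psi:U\to W$ is orthogonal (inner product preserving). In particular, isomorphisms in $\mathfrak{R}$ are the orthogonal isomorphisms of representations. A subrepresentation of a rotational representation is the restriction of both maps to a common invariant subspace, with the induced inner product; it is again rotational. A representation is irreducible if it is non-zero and has no proper non-zero subrepresentation. *)

theory Defs
  imports "HOL-Analysis.Analysis" "HOL-Combinatorics.Permutations"
begin

text \<open>
  A Euclidean space is a finite-dimensional subspace \<open>V\<close> of an arbitrary real inner product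
  space, with the induced inner product; \<open>V = {0}\<close> is allowed. A linear map on \<open>V\<close> is given
  by a function on the ambient type of which only the values on \<open>V\<close> matter. The restriction of a
  representation \<open>(\<sigma>, \<tau>)\<close> on \<open>V\<close> to an invariant subspace \<open>U\<close> is therefore the
  representation given by the same functions \<open>\<sigma>\<close>, \<open>\<tau>\<close> on the carrier \<open>U\<close>.
\<close>

definition euclidean :: "'a::real_inner set \<Rightarrow> bool" where
  "euclidean V \<longleftrightarrow> subspace V \<and> (\<exists>B. finite B \<and> span B = V)"

definition linear_between ::
    "'a::real_vector set \<Rightarrow> 'b::real_vector set \<Rightarrow> ('a \<Rightarrow> 'b) \<Rightarrow> bool" where
  "linear_between V W f \<longleftrightarrow>
     f \<in> V \<rightarrow> W \<and>
     (\<forall>x\<in>V. \<forall>y\<in>V. f (x + y) = f x + f y) \<and>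
     (\<forall>c. \<forall>x\<in>V. f (c *\<^sub>R x) = c *\<^sub>R f x)"

definition preserves_inner_on ::
    "'a::real_inner set \<Rightarrow> ('a \<Rightarrow> 'b::real_inner) \<Rightarrow> bool" where
  "preserves_inner_on U f \<longleftrightarrow> (\<forall>x\<in>U. \<forall>y\<in>U. f x \<bullet> f y = x \<bullet> y)"

definition rotation_in :: "'a::real_inner set \<Rightarrow> ('a \<Rightarrow> 'a) \<Rightarrow> bool" where
  "rotation_in V \<delta> \<longleftrightarrow>
     linear_between V V \<delta> \<and> preserves_inner_on V \<delta> \<and>
     (\<forall>v\<in>V. \<delta> (\<delta> v) \<in> span {v, \<delta> v}) \<and>
     (\<forall>v\<in>V. \<forall>w\<in>V. norm v = 1 \<longrightarrow> norm w = 1 \<longrightarrow> v \<bullet> \<delta> v = w \<bullet> \<delta> w)"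

definition rotational_rep ::
    "'a::real_inner set \<Rightarrow> ('a \<Rightarrow> 'a) \<Rightarrow> ('a \<Rightarrow> 'a) \<Rightarrow> bool" where
  "rotational_rep V \<delta> \<epsilon> \<longleftrightarrow> euclidean V \<and> rotation_in V \<delta> \<and> rotation_in V \<epsilon>"

definition subrep ::
    "'a::real_inner set \<Rightarrow> 'a set \<Rightarrow> ('a \<Rightarrow> 'a) \<Rightarrow> ('a \<Rightarrow> 'a) \<Rightarrow> bool" where
  "subrep U V \<sigma> \<tau> \<longleftrightarrow> subspace U \<and> U \<subseteq> V \<and> \<sigma> ` U \<subseteq> U \<and> \<tau> ` U \<subseteq> U"

definition irreducible_rep ::
    "'a::real_inner set \<Rightarrow> ('a \<Rightarrow> 'a) \<Rightarrow> ('a \<Rightarrow> 'a) \<Rightarrow> bool" where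
  "irreducible_rep V \<sigma> \<tau> \<longleftrightarrow>
     V \<noteq> {0} \<and> (\<forall>U. subrep U V \<sigma> \<tau> \<longrightarrow> U = {0} \<or> U = V)"

definition internal_direct_sum :: "nat \<Rightarrow> (nat \<Rightarrow> 'a::real_vector set) \<Rightarrow> 'a set \<Rightarrow> bool" where
  "internal_direct_sum k U V \<longleftrightarrow>
     (\<forall>i<k. subspace (U i) \<and> U i \<subseteq> V) \<and>
     (\<forall>v\<in>V. \<exists>!u. u \<in> (\<Pi>\<^sub>E i\<in>{..<k}. U i) \<and> (\<Sum>i<k. u i) = v)"

text \<open>
  The sum in a decomposition is the direct sum of representations; the summands are not required to
  be pairwise orthogonal, so orthogonal decompositions are included as a special case.
\<close>

definition irreducible_decomposition ::
    "nat \<Rightarrow> (nat \<Rightarrow> 'a::real_inner set) \<Rightarrow> 'a set \<Rightarrow> ('a \<Rightarrow> 'a) \<Rightarrow> ('a \<Rightarrow> 'a) \<Rightarrow> bool" where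
  "irreducible_decomposition k U V \<delta> \<epsilon> \<longleftrightarrow>
     internal_direct_sum k U V \<and>
     (\<forall>i<k. subrep (U i) V \<delta> \<epsilon> \<and> irreducible_rep (U i) \<delta> \<epsilon>)"

definition kernel_on :: "'a::real_vector set \<Rightarrow> ('a \<Rightarrow> 'b::real_vector) \<Rightarrow> 'a set" where
  "kernel_on V \<phi> = {v\<in>V. \<phi> v = 0}"

definition orth_compl_in :: "'a::real_inner set \<Rightarrow> 'a set \<Rightarrow> 'a set" where
  "orth_compl_in V K = {v\<in>V. \<forall>x\<in>K. v \<bullet> x = 0}"

definition rep_hom ::
    "'a::real_vector set \<Rightarrow> ('a \<Rightarrow> 'a) \<Rightarrow> ('a \<Rightarrow> 'a) \<Rightarrow>
     'b::real_vector set \<Rightarrow> ('b \<Rightarrow> 'b) \<Rightarrow> ('b \<Rightarrow> 'b) \<Rightarrow> ('a \<Rightarrow> 'b) \<Rightarrow> bool" where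
  "rep_hom V \<delta> \<epsilon> W \<sigma> \<tau> \<phi> \<longleftrightarrow>
     linear_between V W \<phi> \<and> (\<forall>v\<in>V. \<phi> (\<delta> v) = \<sigma> (\<phi> v) \<and> \<phi> (\<epsilon> v) = \<tau> (\<phi> v))"

text \<open>
  As \<open>V\<close> is finite-dimensional, it is the orthogonal sum of \<open>ker \<phi>\<close> and its orthogonal
  complement in \<open>V\<close>, so \<open>\<phi>\<close> is always of the form \<open>\<psi> \<oplus> 0\<close> with \<open>\<psi>\<close> its restriction to the
  complement; the condition on morphisms is that this restriction preserves inner products.
\<close>

definition rot_hom ::
    "'a::real_inner set \<Rightarrow> ('a \<Rightarrow> 'a) \<Rightarrow> ('a \<Rightarrow> 'a) \<Rightarrow>
     'b::real_inner set \<Rightarrow> ('b \<Rightarrow> 'b) \<Rightarrow> ('b \<Rightarrow> 'b) \<Rightarrow> ('a \<Rightarrow> 'b) \<Rightarrow> bool" where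
  "rot_hom V \<delta> \<epsilon> W \<sigma> \<tau> \<phi> \<longleftrightarrow>
     rotational_rep V \<delta> \<epsilon> \<and> rotational_rep W \<sigma> \<tau> \<and>
     rep_hom V \<delta> \<epsilon> W \<sigma> \<tau> \<phi> \<and>
     preserves_inner_on (orth_compl_in V (kernel_on V \<phi>)) \<phi>"

definition rot_isomorphic ::
    "'a::real_inner set \<Rightarrow> ('a \<Rightarrow> 'a) \<Rightarrow> ('a \<Rightarrow> 'a) \<Rightarrow>
     'b::real_inner set \<Rightarrow> ('b \<Rightarrow> 'b) \<Rightarrow> ('b \<Rightarrow> 'b) \<Rightarrow> bool" where
  "rot_isomorphic V \<delta> \<epsilon> W \<sigma> \<tau> \<longleftrightarrow>
     (\<exists>\<phi> \<psi>. rot_hom V \<delta> \<epsilon> W \<sigma> \<tau> \<phi> \<and> rot_hom W \<sigma> \<tau> V \<delta> \<epsilon> \<psi> \<and>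
        (\<forall>v\<in>V. \<psi> (\<phi> v) = v) \<and> (\<forall>w\<in>W. \<phi> (\<psi> w) = w))"

end

theory Submission imports Defs begin

text \<open>
  Write \<open>V = \<Oplus>\<^sub>i U\<^sub>i\<close> and exchange the \<open>U\<^sub>i\<close> for the \<open>U'\<^sub>j\<close> one at a time: some component map
  of the current decomposition which lands in a summand not yet exchanged is nonzero on the next
  \<open>U'\<^sub>j\<close>, hence by Schur an isomorphism onto that summand, which it may replace. An isomorphism
  \<open>\<phi>\<close> of irreducible rotational representations is automatically a multiple of an isometry: if \<open>c\<close>
  is the minimum of \<open>\<parallel>\<phi> x\<parallel>\<close> on the unit sphere, then the null vectors of the positive
  semidefinite invariant form \<open>\<parallel>\<phi> x\<parallel>\<^sup>2 - c\<^sup>2 \<parallel>x\<parallel>\<^sup>2\<close> are a nonzero subrepresentation.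
\<close>

section \<open>Linear maps on Euclidean spaces\<close>

lemma linear_between_sum:
  assumes "linear_between V W f" "subspace V" "\<And>i. i \<in> A \<Longrightarrow> u i \<in> V"
  shows "f (\<Sum>i\<in>A. u i) = (\<Sum>i\<in>A. f (u i))"
proof -
  have "f (0 *\<^sub>R 0) = 0 *\<^sub>R f 0"
    using assms(1,2) unfolding linear_between_def by (blast intro: subspace_0)
  then have f0: "f 0 = 0" by simp
  show ?thesis
    using assms(3)
  proof (induction A rule: infinite_finite_induct)
    case (insert a A)
    have "f (u a + sum u A) = f (u a) + f (sum u A)"
      using assms(1,2) insert.prems unfolding linear_between_def by (simp add: subspace_sum)
    then show ?case using insert by simp
  qed (simp_all add: f0)
qed

lemma linear_between_zero:
  assumes "linear_between V W f" "subspace V"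
  shows "f 0 = 0"
  using linear_between_sum[OF assms, of "{}"] by simp

lemma linear_between_diff:
  assumes "linear_between V W f" "subspace V" "x \<in> V" "y \<in> V"
  shows "f (x - y) = f x - f y"
proof -
  have "f (x + (-1) *\<^sub>R y) = f x + (-1) *\<^sub>R f y"
    using assms unfolding linear_between_def by (metis subspace_scale)
  then show ?thesis by simp
qed

lemma linear_between_mono:
  "linear_between V W f \<Longrightarrow> U \<subseteq> V \<Longrightarrow> f ` U \<subseteq> U' \<Longrightarrow> linear_between U U' f"
  unfolding linear_between_def by blast

section \<open>Orthogonal coordinates and minima on the unit sphere\<close>

lemma orthogonal_expansion:
  fixes C :: "'a::real_inner set"
  assumes "finite C" "pairwise orthogonal C" "x \<in> span C"
  shows "(\<Sum>b\<in>C. ((x \<bullet> b) / (b \<bullet> b)) *\<^sub>R b) = x"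
proof -
  define y where "y = x - (\<Sum>b\<in>C. ((x \<bullet> b) / (b \<bullet> b)) *\<^sub>R b)"
  have "orthogonal y a" if "a \<in> C" for a
  proof -
    \<comment> \<open>Only \<open>b = a\<close> survives. The case \<open>a = 0\<close> is harmless:
      the quotient is then 0 by convention, and so is \<open>x \<bullet> a\<close>.\<close>
    have "(\<Sum>b\<in>C. ((x \<bullet> b) / (b \<bullet> b)) *\<^sub>R b) \<bullet> a = (\<Sum>b\<in>C. if b = a then x \<bullet> a else 0)"
      unfolding inner_sum_left
      using assms(2) that by (intro sum.cong) (auto simp: pairwise_def orthogonal_def)
    then show ?thesis
      using assms(1) that by (simp add: orthogonal_def y_def inner_diff_left)
  qed
  moreover have "y \<in> span C"
    unfolding y_def using assms(3)
    by (intro span_diff span_sum span_scale) (auto intro: span_base)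
  ultimately have "orthogonal y y"
    by (metis orthogonal_to_span)
  then show ?thesis by (simp add: orthogonal_def y_def)
qed

text \<open>The ambient space may be infinite-dimensional, so closed and bounded does not imply
  compact. A compact set is built by adding one generator at a time, as a continuous image of an
  interval times a compact set.\<close>

lemma compact_bounded_combinations:
  fixes C :: "'a::real_normed_vector set"
  assumes "finite C"
  shows "\<exists>K. compact K \<and> K \<subseteq> span C \<and>
    (\<forall>c. (\<forall>b\<in>C. \<bar>c b\<bar> \<le> r b) \<longrightarrow> (\<Sum>b\<in>C. c b *\<^sub>R b) \<in> K)"
  using assms
proof (induction C rule: finite_induct)
  case empty
  show ?case by (rule exI[of _ "{0}"]) simp
next
  case (insert b C)
  then obtain K where K: "compact K" "K \<subseteq> span C"
    "\<And>c. (\<forall>b\<in>C. \<bar>c b\<bar> \<le> r b) \<Longrightarrow> (\<Sum>b\<in>C. c b *\<^sub>R b) \<in> K"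
    by blast
  let ?f = "\<lambda>(t::real, x). t *\<^sub>R b + x"
  have "compact (?f ` ({- r b..r b} \<times> K))"
    using K(1) by (intro compact_continuous_image compact_Times)
      (auto intro!: continuous_intros simp: case_prod_unfold)
  moreover have "?f ` ({- r b..r b} \<times> K) \<subseteq> span (insert b C)"
    using K(2) span_mono[of C "insert b C"]
    by (auto intro!: span_add span_scale intro: span_base)
  moreover have "(\<Sum>b\<in>insert b C. c b *\<^sub>R b) \<in> ?f ` ({- r b..r b} \<times> K)"
    if "\<forall>b\<in>insert b C. \<bar>c b\<bar> \<le> r b" for c
  proof -
    have "(\<Sum>b\<in>insert b C. c b *\<^sub>R b) = ?f (c b, \<Sum>b\<in>C. c b *\<^sub>R b)"
      using insert.hyps by simp
    moreover have "(c b, \<Sum>b\<in>C. c b *\<^sub>R b) \<in> {- r b..r b} \<times> K"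
      using that K(3)[of c] by auto
    ultimately show ?thesis by blast
  qed
  ultimately show ?case by blast
qed

text \<open>The unit sphere of \<open>V\<close> is compact, so the norm of \<phi> attains its
  minimum there, at \<open>u\<close>; homogeneity carries the bound to all of
  \<open>V\<close>.\<close>

lemma euclidean_min_norm:
  fixes V :: "'a::real_inner set" and \<phi> :: "'a \<Rightarrow> 'b::real_inner"
  assumes "euclidean V" "V \<noteq> {0}" "linear_between V W \<phi>"
  obtains u where "u \<in> V" "norm u = 1" "\<And>x. x \<in> V \<Longrightarrow> norm (\<phi> u) * norm x \<le> norm (\<phi> x)"
proof -
  have sV: "subspace V" using assms(1) by (simp add: euclidean_def)
  obtain C where C: "finite C" "span C = V" "pairwise orthogonal C"
    using assms(1) basis_orthogonal unfolding euclidean_def by metis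
  have exp: "(\<Sum>b\<in>C. ((x \<bullet> b) / (b \<bullet> b)) *\<^sub>R b) = x" if "x \<in> V" for x
    using orthogonal_expansion C that by blast
  \<comment> \<open>Nothing is known about \<phi> outside \<open>V\<close>. Its coordinate
    expression \<Phi> agrees with it on \<open>V\<close> and is visibly continuous on the whole
    ambient space.\<close>
  define \<Phi> where "\<Phi> x = (\<Sum>b\<in>C. ((x \<bullet> b) / (b \<bullet> b)) *\<^sub>R \<phi> b)" for x
  have \<Phi>: "\<Phi> x = \<phi> x" if "x \<in> V" for x
  proof -
    have CV: "b \<in> V" if "b \<in> C" for b using C(2) that span_base by blast
    have "\<phi> x = \<phi> (\<Sum>b\<in>C. ((x \<bullet> b) / (b \<bullet> b)) *\<^sub>R b)" using exp[OF that] by simp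
    also have "\<dots> = (\<Sum>b\<in>C. \<phi> (((x \<bullet> b) / (b \<bullet> b)) *\<^sub>R b))"
      using CV sV by (intro linear_between_sum[OF assms(3)]) (auto intro: subspace_scale)
    also have "\<dots> = \<Phi> x"
      unfolding \<Phi>_def using assms(3) CV by (intro sum.cong) (auto simp: linear_between_def)
    finally show ?thesis by simp
  qed
  \<comment> \<open>The radii \<open>1 / norm b\<close> are the Cauchy-Schwarz bounds for the
    coefficients of a unit vector.\<close>
  obtain K where K: "compact K" "K \<subseteq> V"
    "\<And>c. (\<forall>b\<in>C. \<bar>c b\<bar> \<le> 1 / norm b) \<Longrightarrow> (\<Sum>b\<in>C. c b *\<^sub>R b) \<in> K"
    using compact_bounded_combinations[OF C(1), of "\<lambda>b. 1 / norm b"] C(2) by blast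
  have in_K: "x \<in> K" if "x \<in> V" "norm x = 1" for x
  proof -
    have "\<bar>(x \<bullet> b) / (b \<bullet> b)\<bar> \<le> 1 / norm b" for b
    proof (cases "b = 0")
      case False
      have "\<bar>x \<bullet> b\<bar> \<le> norm b" using Cauchy_Schwarz_ineq2[of x b] that by simp
      then show ?thesis using False
        by (simp add: divide_simps dot_square_norm power2_eq_square)
    qed simp
    then show ?thesis using K(3)[of "\<lambda>b. (x \<bullet> b) / (b \<bullet> b)"] exp[OF that(1)] by simp
  qed
  have normalize: "(1 / norm x) *\<^sub>R x \<in> V \<and> norm ((1 / norm x) *\<^sub>R x) = 1"
    if "x \<in> V" "x \<noteq> 0" for x
    using that sV by (simp add: subspace_scale)
  have "V \<noteq> {}" using sV subspace_0 by blast
  then obtain x where "x \<in> V" "x \<noteq> 0" using assms(2) by blast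
  \<comment> \<open>As \<open>K\<close> lies in \<open>V\<close> and contains its unit vectors, this
    intersection is exactly the unit sphere of \<open>V\<close>.\<close>
  then have ne: "K \<inter> sphere 0 1 \<noteq> {}" using normalize in_K by fastforce
  have "sphere 0 1 = {x::'a. norm x = 1}" by auto
  then have "closed (sphere 0 1 :: 'a set)"
    by (simp add: closed_Collect_eq continuous_on_norm_id)
  then have "compact (K \<inter> sphere 0 1)" using K(1) by (rule compact_Int_closed[rotated])
  moreover have "continuous_on (K \<inter> sphere 0 1) (\<lambda>x. norm (\<Phi> x))"
    unfolding \<Phi>_def divide_inverse by (intro continuous_intros)
  ultimately obtain u where u: "u \<in> K \<inter> sphere 0 1"
    "\<And>x. x \<in> K \<inter> sphere 0 1 \<Longrightarrow> norm (\<Phi> u) \<le> norm (\<Phi> x)"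
    using continuous_attains_inf[OF _ ne] by blast
  have uV: "u \<in> V" "norm u = 1" using u K(2) by auto
  have "norm (\<phi> u) * norm x \<le> norm (\<phi> x)" if "x \<in> V" for x
  proof (cases "x = 0")
    case False
    define y where "y = (1 / norm x) *\<^sub>R x"
    have y: "y \<in> V" "norm y = 1" using normalize[OF that False] by (auto simp: y_def)
    then have "norm (\<phi> u) \<le> norm (\<phi> y)"
      using u(2)[of y] in_K[of y] \<Phi> uV by simp
    also have "\<phi> y = (1 / norm x) *\<^sub>R \<phi> x"
      using assms(3) that by (simp add: linear_between_def y_def)
    finally show ?thesis using False by (simp add: field_simps)
  qed simp
  with uV show ?thesis by (rule that)
qed

lemma euclidean_subspace:
  assumes "euclidean V" "subspace U" "U \<subseteq> V"
  shows "euclidean U"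
proof -
  obtain B where B: "finite B" "span B = V" using assms(1) by (auto simp: euclidean_def)
  obtain A where A: "A \<subseteq> U" "independent A" "U \<subseteq> span A"
    using maximal_independent_subset by blast
  have "finite A" using independent_span_bound[OF B(1) A(2)] A(1) assms(3) B(2) by blast
  moreover have "span A = U" using A assms(2) by (metis span_minimal subset_antisym)
  ultimately show ?thesis using assms(2) by (auto simp: euclidean_def)
qed

section \<open>Irreducible rotational representations\<close>

lemma rotational_subrep:
  assumes "rotational_rep V \<delta> \<epsilon>" "subrep U V \<delta> \<epsilon>"
  shows "rotational_rep U \<delta> \<epsilon>"
proof -
  have "rotation_in U \<rho>" if "rotation_in V \<rho>" "\<rho> ` U \<subseteq> U" for \<rho>
    using that assms(2) linear_between_mono[of V V \<rho> U U]
    unfolding rotation_in_def preserves_inner_on_def subrep_def by (meson subsetD)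
  then show ?thesis
    using assms euclidean_subspace unfolding rotational_rep_def subrep_def by blast
qed

text \<open>Linearity of \<sigma> and \<tau> is not assumed; that they fix 0 is what makes \<phi>
  vanish on the images of kernel vectors.\<close>

lemma subrep_kernel_on:
  assumes "rep_hom V \<delta> \<epsilon> W \<sigma> \<tau> \<phi>" "subspace V" "subspace W"
    "\<delta> ` V \<subseteq> V" "\<epsilon> ` V \<subseteq> V" "\<sigma> 0 = 0" "\<tau> 0 = 0"
  shows "subrep (kernel_on V \<phi>) V \<delta> \<epsilon>"
proof -
  have lin: "linear_between V W \<phi>" using assms(1) by (simp add: rep_hom_def)
  have "subspace (kernel_on V \<phi>)"
    unfolding kernel_on_def using assms(2) lin linear_between_zero[OF lin assms(2)]
    by (auto simp: subspace_def linear_between_def)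
  then show ?thesis
    using assms unfolding subrep_def kernel_on_def rep_hom_def by auto
qed

lemma subrep_image:
  assumes "rep_hom V \<delta> \<epsilon> W \<sigma> \<tau> \<phi>" "subspace V" "\<delta> ` V \<subseteq> V" "\<epsilon> ` V \<subseteq> V"
  shows "subrep (\<phi> ` V) W \<sigma> \<tau>"
proof -
  have lin: "linear_between V W \<phi>" using assms(1) by (simp add: rep_hom_def)
  have "subspace (\<phi> ` V)"
  proof (rule subspaceI)
    show "0 \<in> \<phi> ` V"
      using linear_between_zero[OF lin assms(2)] subspace_0[OF assms(2)] by force
  next
    fix x y assume "x \<in> \<phi> ` V" "y \<in> \<phi> ` V"
    then obtain a b where "a \<in> V" "b \<in> V" "x = \<phi> a" "y = \<phi> b" by blast
    then have "x + y = \<phi> (a + b)" "a + b \<in> V"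
      using lin assms(2) by (auto simp: linear_between_def subspace_add)
    then show "x + y \<in> \<phi> ` V" by blast
  next
    fix c x assume "x \<in> \<phi> ` V"
    then obtain a where "a \<in> V" "x = \<phi> a" by blast
    then have "c *\<^sub>R x = \<phi> (c *\<^sub>R a)" "c *\<^sub>R a \<in> V"
      using lin assms(2) by (auto simp: linear_between_def subspace_scale)
    then show "c *\<^sub>R x \<in> \<phi> ` V" by blast
  qed
  moreover have "\<sigma> (\<phi> v) \<in> \<phi> ` V" "\<tau> (\<phi> v) \<in> \<phi> ` V" if "v \<in> V" for v
    using assms(1,3,4) that unfolding rep_hom_def by (metis image_eqI image_subset_iff)+
  ultimately show ?thesis
    using lin unfolding subrep_def linear_between_def by auto
qed

text \<open>The kernel misses \<open>x\<close>, so it is \<open>{0}\<close>; the image contains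
  \<open>\<phi> x \<noteq> 0\<close>, so it is \<open>W\<close>.\<close>

lemma schur_bij_betw:
  assumes "rotational_rep V \<delta> \<epsilon>" "rotational_rep W \<sigma> \<tau>"
    "irreducible_rep V \<delta> \<epsilon>" "irreducible_rep W \<sigma> \<tau>"
    "rep_hom V \<delta> \<epsilon> W \<sigma> \<tau> \<phi>" "x \<in> V" "\<phi> x \<noteq> 0"
  shows "bij_betw \<phi> V W"
proof -
  have s: "subspace V" "subspace W" "\<delta> ` V \<subseteq> V" "\<epsilon> ` V \<subseteq> V"
    using assms(1,2)
    by (auto simp: rotational_rep_def euclidean_def rotation_in_def linear_between_def)
  have z: "\<sigma> 0 = 0" "\<tau> 0 = 0"
    using assms(2) s(2) linear_between_zero[of W W]
    by (auto simp: rotational_rep_def rotation_in_def)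
  have lin: "linear_between V W \<phi>" using assms(5) by (simp add: rep_hom_def)
  have "kernel_on V \<phi> = {0}"
    using subrep_kernel_on[OF assms(5) s z] assms(3,6,7)
    unfolding irreducible_rep_def kernel_on_def by blast
  then have "inj_on \<phi> V"
    using linear_between_diff[OF lin s(1)] subspace_diff[OF s(1)]
    by (intro inj_onI) (force simp: kernel_on_def set_eq_iff)
  moreover have "\<phi> ` V = W"
    using subrep_image[OF assms(5) s(1,3,4)] assms(4,6,7)
    unfolding irreducible_rep_def by blast
  ultimately show ?thesis by (simp add: bij_betw_def)
qed

text \<open>In effect the adjoint of \<phi> composed with \<phi> is a scalar:
  \<open>c\<^sup>2\<close> is its least eigenvalue, and the eigenspace \<open>N\<close> is invariant
  and nonzero. The zero map is covered by \<open>c = 0\<close>.\<close>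

lemma irreducible_hom_conformal:
  assumes "rotational_rep V \<delta> \<epsilon>" "rotational_rep W \<sigma> \<tau>" "irreducible_rep V \<delta> \<epsilon>"
    "rep_hom V \<delta> \<epsilon> W \<sigma> \<tau> \<phi>"
  obtains c where "c \<ge> 0" "\<And>x. x \<in> V \<Longrightarrow> norm (\<phi> x) = c * norm x"
proof -
  have lin: "linear_between V W \<phi>" and sV: "subspace V"
    using assms(1,4) by (auto simp: rep_hom_def rotational_rep_def euclidean_def)
  obtain u where u: "u \<in> V" "norm u = 1"
    "\<And>x. x \<in> V \<Longrightarrow> norm (\<phi> u) * norm x \<le> norm (\<phi> x)"
    using euclidean_min_norm[OF _ _ lin] assms(1,3)
    unfolding rotational_rep_def irreducible_rep_def by metis
  define c where "c = norm (\<phi> u)"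
  define q where "q x = \<phi> x \<bullet> \<phi> x - c\<^sup>2 * (x \<bullet> x)" for x
  have q_norm: "q x = (norm (\<phi> x))\<^sup>2 - (c * norm x)\<^sup>2" for x
    by (simp add: q_def dot_square_norm power_mult_distrib)
  have q_nonneg: "q x \<ge> 0" if "x \<in> V" for x
    using u(3)[OF that] unfolding q_norm c_def by (simp add: power_mono)
  \<comment> \<open>For null vectors \<open>x\<close> and \<open>y\<close> this makes two
    nonnegative values add up to 0, so \<open>x + y\<close> is null as well.\<close>
  have parallelogram: "q (x + y) + q (x - y) = 2 * q x + 2 * q y" if "x \<in> V" "y \<in> V" for x y
  proof -
    have "\<phi> (x + y) = \<phi> x + \<phi> y" "\<phi> (x - y) = \<phi> x - \<phi> y"
      using lin linear_between_diff[OF lin sV] that by (auto simp: linear_between_def)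
    then show ?thesis
      by (simp only: q_def inner_add_left inner_add_right inner_diff_left inner_diff_right)
        (simp add: algebra_simps)
  qed
  have q_scale: "q (a *\<^sub>R x) = a\<^sup>2 * q x" if "x \<in> V" for a x
    using lin that by (simp add: q_def linear_between_def power2_eq_square algebra_simps)
  define N where "N = {x \<in> V. q x = 0}"
  have "subspace N"
  proof (rule subspaceI)
    show "0 \<in> N"
      using sV linear_between_zero[OF lin sV] by (simp add: N_def q_def subspace_0)
    show "x + y \<in> N" if "x \<in> N" "y \<in> N" for x y
    proof -
      have xy: "x \<in> V" "y \<in> V" "x + y \<in> V" "x - y \<in> V"
        using that sV by (auto simp: N_def subspace_add subspace_diff)
      then show ?thesis
        using parallelogram[of x y] q_nonneg[of "x + y"] q_nonneg[of "x - y"] that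
        by (simp add: N_def)
    qed
    show "a *\<^sub>R x \<in> N" if "x \<in> N" for a x
      using that sV q_scale by (simp add: N_def subspace_scale)
  qed
  \<comment> \<open>Equivariance turns \<open>\<phi> (\<delta> x)\<close> into
    \<open>\<sigma> (\<phi> x)\<close>; both terms of \<open>q\<close> are then kept because
    \<delta> and \<sigma> preserve inner products, and likewise for \<epsilon> and \<tau>.\<close>
  moreover have "q (\<delta> x) = q x" "q (\<epsilon> x) = q x" "\<delta> x \<in> V" "\<epsilon> x \<in> V" if "x \<in> V" for x
  proof -
    have "\<phi> x \<in> W" using lin that by (auto simp: linear_between_def)
    then show "q (\<delta> x) = q x" "q (\<epsilon> x) = q x" "\<delta> x \<in> V" "\<epsilon> x \<in> V"
      using assms(1,2,4) that
      by (auto simp: q_def rep_hom_def rotational_rep_def rotation_in_def linear_between_def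
          preserves_inner_on_def)
  qed
  ultimately have "subrep N V \<delta> \<epsilon>" by (auto simp: subrep_def N_def)
  moreover have "u \<in> N" using u by (simp add: N_def q_norm c_def)
  ultimately have "N = V" using assms(3) u(2) by (auto simp: irreducible_rep_def)
  then have "(norm (\<phi> x))\<^sup>2 = (c * norm x)\<^sup>2" if "x \<in> V" for x
    using that unfolding N_def q_norm by auto
  then have "norm (\<phi> x) = c * norm x" if "x \<in> V" for x
    using that by (simp add: power2_eq_iff_nonneg c_def)
  then show ?thesis using that[of c] by (simp add: c_def)
qed

text \<open>Dividing the conformal map \<phi> by its factor gives an isometry on all of
  \<open>V\<close>, hence on the orthogonal complement of its kernel, so the morphism condition
  holds.\<close>

lemma irreducible_hom_rot_isomorphic:
  fixes V :: "'a::real_inner set" and W :: "'b::real_inner set"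
  assumes "rotational_rep V \<delta> \<epsilon>" "rotational_rep W \<sigma> \<tau>"
    "irreducible_rep V \<delta> \<epsilon>" "rep_hom V \<delta> \<epsilon> W \<sigma> \<tau> \<phi>" "bij_betw \<phi> V W"
  shows "rot_isomorphic V \<delta> \<epsilon> W \<sigma> \<tau>"
proof -
  have lin: "linear_between V W \<phi>" and sV: "subspace V" and sW: "subspace W"
    using assms(1,2,4) by (auto simp: rep_hom_def rotational_rep_def euclidean_def)
  obtain c where c: "c \<ge> 0" "\<And>x. x \<in> V \<Longrightarrow> norm (\<phi> x) = c * norm x"
    using irreducible_hom_conformal[OF assms(1-4)] by blast
  obtain x where x: "x \<in> V" "x \<noteq> 0"
    using assms(3) subspace_0[OF sV] unfolding irreducible_rep_def by blast
  \<comment> \<open>With \<open>c = 0\<close> the map would vanish at the nonzero \<open>x\<close>,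
    against injectivity.\<close>
  have "\<phi> x \<noteq> \<phi> 0" using assms(5) x subspace_0[OF sV] by (metis bij_betw_def inj_onD)
  then have "c > 0" using c x linear_between_zero[OF lin sV] by (cases "c = 0") auto
  have \<phi>_add: "\<phi> (x + y) = \<phi> x + \<phi> y" if "x \<in> V" "y \<in> V" for x y
    using lin that by (simp add: linear_between_def)
  have \<phi>_scale: "\<phi> (a *\<^sub>R x) = a *\<^sub>R \<phi> x" if "x \<in> V" for a x
    using lin that by (simp add: linear_between_def)
  \<comment> \<open>Polarization: compare the squared norms of the images of \<open>x\<close>,
    \<open>y\<close> and \<open>x + y\<close>.\<close>
  have \<phi>_inner: "\<phi> x \<bullet> \<phi> y = c\<^sup>2 * (x \<bullet> y)" if "x \<in> V" "y \<in> V" for x y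
  proof -
    have "(norm (\<phi> x + \<phi> y))\<^sup>2 = (c * norm (x + y))\<^sup>2"
      using c(2)[of "x + y"] \<phi>_add that sV by (simp add: subspace_add)
    moreover have "(norm (\<phi> x))\<^sup>2 = (c * norm x)\<^sup>2" "(norm (\<phi> y))\<^sup>2 = (c * norm y)\<^sup>2"
      using c(2) that by auto
    ultimately show ?thesis
      by (simp add: power_mult_distrib power2_norm_eq_inner inner_add_left inner_add_right
          inner_commute algebra_simps)
  qed
  define f where "f x = (1 / c) *\<^sub>R \<phi> x" for x
  define g where "g y = c *\<^sub>R inv_into V \<phi> y" for y
  have \<phi>W: "\<phi> x \<in> W" if "x \<in> V" for x using lin that by (auto simp: linear_between_def)
  have fW: "f x \<in> W" if "x \<in> V" for x
    using \<phi>W[OF that] sW by (simp add: f_def subspace_scale)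
  have invV: "inv_into V \<phi> y \<in> V" "\<phi> (inv_into V \<phi> y) = y" if "y \<in> W" for y
    using assms(5) that by (auto simp: bij_betw_def inv_into_into f_inv_into_f)
  have gV: "g y \<in> V" if "y \<in> W" for y
    using invV[OF that] sV by (simp add: g_def subspace_scale)
  have fg: "f (g y) = y" if "y \<in> W" for y
    using invV[OF that] \<phi>_scale \<open>c > 0\<close> by (simp add: f_def g_def)
  have f_add: "f (x + y) = f x + f y" if "x \<in> V" "y \<in> V" for x y
    using \<phi>_add that by (simp add: f_def scaleR_add_right)
  have f_scale: "f (a *\<^sub>R x) = a *\<^sub>R f x" if "x \<in> V" for a x
    using \<phi>_scale that by (simp add: f_def)
  have f_inj: "x = y" if "f x = f y" "x \<in> V" "y \<in> V" for x y
  proof -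
    have "\<phi> x = \<phi> y" using that(1) \<open>c > 0\<close> by (simp add: f_def)
    then show ?thesis using assms(5) that by (auto simp: bij_betw_def inj_on_def)
  qed
  have f_inner: "f x \<bullet> f y = x \<bullet> y" if "x \<in> V" "y \<in> V" for x y
    using \<phi>_inner[OF that] \<open>c > 0\<close> by (simp add: f_def power2_eq_square)
  have gf: "g (f x) = x" if "x \<in> V" for x
    by (rule f_inj) (use that fg fW gV in auto)
  have inV: "\<delta> x \<in> V" "\<epsilon> x \<in> V" if "x \<in> V" for x
    using assms(1) that by (auto simp: rotational_rep_def rotation_in_def linear_between_def)
  have inW: "\<sigma> y \<in> W" "\<tau> y \<in> W" if "y \<in> W" for y
    using assms(2) that by (auto simp: rotational_rep_def rotation_in_def linear_between_def)
  have equi: "f (\<delta> x) = \<sigma> (f x)" "f (\<epsilon> x) = \<tau> (f x)" if "x \<in> V" for x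
    using assms(2,4) that \<phi>W[OF that]
    by (auto simp: f_def rep_hom_def rotational_rep_def rotation_in_def linear_between_def)
  have "rot_hom V \<delta> \<epsilon> W \<sigma> \<tau> f"
    unfolding rot_hom_def rep_hom_def linear_between_def preserves_inner_on_def
      orth_compl_in_def
    using assms(1,2) fW f_add f_scale equi f_inner by simp
  moreover have "rot_hom W \<sigma> \<tau> V \<delta> \<epsilon> g"
  proof -
    \<comment> \<open>Linearity and equivariance of \<open>g\<close> are checked after applying
      \<open>f\<close>, which is injective on \<open>V\<close> and has \<open>g\<close> as right
      inverse.\<close>
    have "g (x + y) = g x + g y" if "x \<in> W" "y \<in> W" for x y
      by (rule f_inj) (use that sV sW gV fg f_add in \<open>auto simp: subspace_add\<close>)
    moreover have "g (a *\<^sub>R x) = a *\<^sub>R g x" if "x \<in> W" for a x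
      by (rule f_inj) (use that sV sW gV fg f_scale in \<open>auto simp: subspace_scale\<close>)
    moreover have "g (\<sigma> x) = \<delta> (g x)" "g (\<tau> x) = \<epsilon> (g x)" if "x \<in> W" for x
      by (rule f_inj; use that inV inW gV fg equi in auto)+
    moreover have "g x \<bullet> g y = x \<bullet> y" if "x \<in> W" "y \<in> W" for x y
      using f_inner[OF gV gV] fg that by simp
    ultimately show ?thesis
      unfolding rot_hom_def rep_hom_def linear_between_def preserves_inner_on_def
        orth_compl_in_def
      using assms(1,2) gV by simp
  qed
  ultimately show ?thesis
    unfolding rot_isomorphic_def using fg gf by blast
qed

lemma rot_isomorphic_sym:
  "rot_isomorphic V \<delta> \<epsilon> W \<sigma> \<tau> \<Longrightarrow> rot_isomorphic W \<sigma> \<tau> V \<delta> \<epsilon>"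
  unfolding rot_isomorphic_def by blast

section \<open>Direct sums and the exchange step\<close>

text \<open>Uniqueness of expansions means that only the trivial relation exists. Here families are
  arbitrary outside the index range, which spares later arguments the extensional functions.\<close>

lemma internal_direct_sum_iff:
  assumes "subspace V"
  shows "internal_direct_sum k W V \<longleftrightarrow>
    (\<forall>i<k. subspace (W i) \<and> W i \<subseteq> V) \<and>
    (\<forall>v\<in>V. \<exists>u. (\<forall>i<k. u i \<in> W i) \<and> (\<Sum>i<k. u i) = v) \<and>
    (\<forall>u. (\<forall>i<k. u i \<in> W i) \<longrightarrow> (\<Sum>i<k. u i) = 0 \<longrightarrow> (\<forall>i<k. u i = 0))"
    (is "?L \<longleftrightarrow> ?A \<and> ?B \<and> ?C")
proof (intro iffI conjI)
  assume L: ?L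
  show A: ?A using L by (simp add: internal_direct_sum_def)
  show ?B
  proof
    fix v assume "v \<in> V"
    with L obtain u where "u \<in> (\<Pi>\<^sub>E i\<in>{..<k}. W i)" "(\<Sum>i<k. u i) = v"
      unfolding internal_direct_sum_def by blast
    then show "\<exists>u. (\<forall>i<k. u i \<in> W i) \<and> (\<Sum>i<k. u i) = v" by (intro exI[of _ u]) auto
  qed
  show ?C
  proof (intro allI impI)
    fix u i assume u: "\<forall>i<k. u i \<in> W i" "(\<Sum>i<k. u i) = 0" and "i < k"
    \<comment> \<open>Both restrictions are extensional expansions of 0, so uniqueness identifies
      them.\<close>
    let ?r = "restrict u {..<k}" and ?z = "restrict (\<lambda>_. 0) {..<k}"
    have "?r \<in> (\<Pi>\<^sub>E i\<in>{..<k}. W i) \<and> (\<Sum>i<k. ?r i) = 0" using u by auto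
    moreover have "?z \<in> (\<Pi>\<^sub>E i\<in>{..<k}. W i) \<and> (\<Sum>i<k. ?z i) = 0"
      using A by (auto simp: subspace_0)
    moreover obtain z where
      "\<And>u. u \<in> (\<Pi>\<^sub>E i\<in>{..<k}. W i) \<and> (\<Sum>i<k. u i) = 0 \<Longrightarrow> u = z"
      using L subspace_0[OF assms] unfolding internal_direct_sum_def by (metis (no_types, lifting))
    ultimately have "?r = z" "?z = z" by blast+
    then have "?r = ?z" by (simp only:)
    then have "?r i = ?z i" by (rule fun_cong)
    then show "u i = 0" using \<open>i < k\<close> by simp
  qed
next
  assume R: "?A \<and> ?B \<and> ?C"
  show ?L
    unfolding internal_direct_sum_def
  proof (intro conjI ballI)
    show ?A by (rule conjunct1[OF R])
    fix v assume "v \<in> V"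
    with R[THEN conjunct2, THEN conjunct1]
    obtain u where u: "\<forall>i<k. u i \<in> W i" "(\<Sum>i<k. u i) = v" by blast
    show "\<exists>!u. u \<in> (\<Pi>\<^sub>E i\<in>{..<k}. W i) \<and> (\<Sum>i<k. u i) = v"
    proof (rule ex1I)
      show "restrict u {..<k} \<in> (\<Pi>\<^sub>E i\<in>{..<k}. W i) \<and> (\<Sum>i<k. restrict u {..<k} i) = v"
        using u by auto
      fix w assume w: "w \<in> (\<Pi>\<^sub>E i\<in>{..<k}. W i) \<and> (\<Sum>i<k. w i) = v"
      have "\<forall>i<k. w i - u i \<in> W i"
        using w u(1) R by (auto intro!: subspace_diff)
      moreover have "(\<Sum>i<k. w i - u i) = 0" using w u by (simp add: sum_subtractf)
      ultimately have "\<forall>i<k. w i - u i = 0"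
        by (rule R[THEN conjunct2, THEN conjunct2, THEN spec, THEN mp, THEN mp])
      then show "w = restrict u {..<k}"
        using w by (intro PiE_ext[of _ "{..<k}" W]) (use u in auto)
    qed
  qed
qed

text \<open>The \<open>p i\<close> are the projections. The last property is the working form of
  uniqueness: any expansion of \<open>v\<close>, however obtained, exhibits its components.\<close>

lemma direct_sum_components:
  assumes "subspace V" "internal_direct_sum k W V"
  obtains p where
    "\<And>i v. i < k \<Longrightarrow> v \<in> V \<Longrightarrow> p i v \<in> W i"
    "\<And>v. v \<in> V \<Longrightarrow> (\<Sum>i<k. p i v) = v"
    "\<And>u v i. v \<in> V \<Longrightarrow> (\<And>j. j < k \<Longrightarrow> u j \<in> W j) \<Longrightarrow> (\<Sum>j<k. u j) = v \<Longrightarrow> i < k \<Longrightarrow> p i v = u i"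
proof -
  note D = assms(2)[unfolded internal_direct_sum_iff[OF assms(1)]]
  then obtain q where q: "\<And>v. v \<in> V \<Longrightarrow> (\<forall>i<k. q v i \<in> W i) \<and> (\<Sum>i<k. q v i) = v"
    by metis
  have "q v i = u i" if "v \<in> V" "\<And>j. j < k \<Longrightarrow> u j \<in> W j" "(\<Sum>j<k. u j) = v" "i < k" for u v i
  proof -
    have "\<forall>j<k. q v j - u j \<in> W j" using q that D by (auto intro: subspace_diff)
    moreover have "(\<Sum>j<k. q v j - u j) = 0" using q that by (simp add: sum_subtractf)
    ultimately have "q v i - u i = 0"
      using \<open>i < k\<close> by (rule D[THEN conjunct2, THEN conjunct2, THEN spec, THEN mp, THEN mp, THEN spec, THEN mp])
    then show ?thesis by simp
  qed
  then show ?thesis using q that[of "\<lambda>i v. q v i"] by blast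
qed

text \<open>Applying \<delta> to the components of \<open>v\<close> gives an expansion of
  \<open>\<delta> v\<close> along the same invariant summands, so its terms are the components of
  \<open>\<delta> v\<close>. Sums and multiples are treated alike.\<close>

lemma component_rep_hom:
  assumes "linear_between V V \<delta>" "linear_between V V \<epsilon>" "subspace V"
    and W: "\<And>j. j < k \<Longrightarrow> subrep (W j) V \<delta> \<epsilon>"
    and p: "\<And>i v. i < k \<Longrightarrow> v \<in> V \<Longrightarrow> p i v \<in> W i"
      "\<And>v. v \<in> V \<Longrightarrow> (\<Sum>i<k. p i v) = v"
      "\<And>u v i. v \<in> V \<Longrightarrow> (\<And>j. j < k \<Longrightarrow> u j \<in> W j) \<Longrightarrow> (\<Sum>j<k. u j) = v \<Longrightarrow> i < k \<Longrightarrow> p i v = u i"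
    and "i < k"
  shows "rep_hom V \<delta> \<epsilon> (W i) \<delta> \<epsilon> (p i)"
proof -
  have sW: "subspace (W j)" "W j \<subseteq> V" if "j < k" for j using W[OF that] by (auto simp: subrep_def)
  have inv: "p i (\<rho> v) = \<rho> (p i v)"
    if "linear_between V V \<rho>" "\<And>j. j < k \<Longrightarrow> \<rho> ` W j \<subseteq> W j" "v \<in> V" for \<rho> v
  proof (rule p(3)[of _ "\<lambda>j. \<rho> (p j v)"])
    show "\<rho> v \<in> V" using that by (auto simp: linear_between_def)
    show "\<rho> (p j v) \<in> W j" if "j < k" for j
      using that \<open>v \<in> V\<close> p(1) \<open>\<And>j. j < k \<Longrightarrow> \<rho> ` W j \<subseteq> W j\<close> by blast
    have "\<rho> (\<Sum>j<k. p j v) = (\<Sum>j<k. \<rho> (p j v))"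
      by (rule linear_between_sum[OF that(1) assms(3)]) (use that p(1) sW in blast)
    then show "(\<Sum>j<k. \<rho> (p j v)) = \<rho> v" using p(2)[OF that(3)] by simp
  qed fact
  have "p i (x + y) = p i x + p i y" if "x \<in> V" "y \<in> V" for x y
    by (rule p(3)[of _ "\<lambda>j. p j x + p j y"])
      (use that p(1,2) sW assms(3) \<open>i < k\<close> in \<open>auto simp: subspace_add sum.distrib\<close>)
  moreover have "p i (c *\<^sub>R x) = c *\<^sub>R p i x" if "x \<in> V" for c x
    by (rule p(3)[of _ "\<lambda>j. c *\<^sub>R p j x"])
      (use that p(1,2) sW assms(3) \<open>i < k\<close> in
        \<open>auto simp: subspace_scale simp flip: scaleR_sum_right\<close>)
  ultimately show ?thesis
    unfolding rep_hom_def linear_between_def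
    using p(1)[OF \<open>i < k\<close>] inv[OF assms(1)] inv[OF assms(2)] W by (simp add: subrep_def)
qed

text \<open>The other summands together form the kernel of \<open>p i\<close> on \<open>V\<close>.
  Since \<open>p i\<close> maps \<open>M\<close> bijectively onto \<open>W i\<close>,
  \<open>M\<close> is a complement of that kernel.\<close>

lemma internal_direct_sum_exchange:
  assumes "subspace V" "internal_direct_sum k W V" "subspace M" "M \<subseteq> V" "i < k"
    and p: "\<And>i v. i < k \<Longrightarrow> v \<in> V \<Longrightarrow> p i v \<in> W i"
      "\<And>v. v \<in> V \<Longrightarrow> (\<Sum>i<k. p i v) = v"
      "\<And>u v i. v \<in> V \<Longrightarrow> (\<And>j. j < k \<Longrightarrow> u j \<in> W j) \<Longrightarrow> (\<Sum>j<k. u j) = v \<Longrightarrow> i < k \<Longrightarrow> p i v = u i"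
    and bij: "bij_betw (p i) M (W i)"
  shows "internal_direct_sum k (W(i := M)) V"
proof -
  note D = assms(2)[unfolded internal_direct_sum_iff[OF assms(1)]]
  have split: "(\<Sum>j<k. h j) = h i + (\<Sum>j\<in>{..<k} - {i}. h j)" for h :: "nat \<Rightarrow> 'a"
    using \<open>i < k\<close> by (simp add: sum.remove)
  have p0: "p i 0 = 0"
    by (rule p(3)[of _ "\<lambda>_. 0"])
      (use D \<open>i < k\<close> assms(1) in \<open>auto simp: subspace_0\<close>)
  have "\<exists>u. (\<forall>j<k. u j \<in> (W(i := M)) j) \<and> (\<Sum>j<k. u j) = v" if "v \<in> V" for v
  proof -
    \<comment> \<open>This \<open>x\<close> shares its component at \<open>i\<close> with
      \<open>v\<close>, so \<open>v - x\<close> expands over the other summands alone.\<close>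
    obtain x where x: "x \<in> M" "p i x = p i v"
      using bij p(1)[OF \<open>i < k\<close> \<open>v \<in> V\<close>] unfolding bij_betw_def by (metis imageE)
    then have "x \<in> V" using assms(4) by blast
    define u where "u j = (if j = i then x else p j v - p j x)" for j
    have "(\<Sum>j\<in>{..<k} - {i}. u j) = (\<Sum>j\<in>{..<k} - {i}. p j v - p j x)"
      by (intro sum.cong) (auto simp: u_def)
    also have "\<dots> = (\<Sum>j<k. p j v - p j x)" using split[of "\<lambda>j. p j v - p j x"] x by simp
    also have "\<dots> = v - x" using p(2) that \<open>x \<in> V\<close> by (simp add: sum_subtractf)
    finally have "(\<Sum>j<k. u j) = v" using split[of u] by (simp add: u_def)
    moreover have "\<forall>j<k. u j \<in> (W(i := M)) j"
      using x p(1) that \<open>x \<in> V\<close> D by (auto simp: u_def subspace_diff)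
    ultimately show ?thesis by blast
  qed
  moreover have "\<forall>j<k. u j = 0"
    if u: "\<forall>j<k. u j \<in> (W(i := M)) j" "(\<Sum>j<k. u j) = 0" for u
  proof -
    have uM: "u i \<in> M" using u \<open>i < k\<close> by auto
    have ui: "u i = - (\<Sum>j\<in>{..<k} - {i}. u j)" using split[of u] u(2) by (simp add: eq_neg_iff_add_eq_0)
    \<comment> \<open>The relation expresses \<open>u i\<close> through the other summands;
      \<open>w\<close> is this expansion, with 0 at position \<open>i\<close>, so \<open>p i\<close>
      kills \<open>u i\<close>.\<close>
    define w where "w j = (if j = i then 0 else - u j)" for j
    have w: "w j \<in> W j" if "j < k" for j
    proof (cases "j = i")
      case False
      then have "u j \<in> W j" using u(1) that by (metis fun_upd_other)
      then show ?thesis using D that False by (simp add: w_def subspace_neg)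
    qed (use D that in \<open>simp add: w_def subspace_0\<close>)
    have "(\<Sum>j\<in>{..<k} - {i}. w j) = (\<Sum>j\<in>{..<k} - {i}. - u j)"
      by (intro sum.cong) (auto simp: w_def)
    then have "(\<Sum>j<k. w j) = u i" using split[of w] ui by (simp add: w_def sum_negf)
    then have "p i (u i) = w i" using p(3)[of "u i" w i] uM assms(4) w \<open>i < k\<close> by blast
    then have "p i (u i) = p i 0" by (simp add: w_def p0)
    then have "u i = 0"
      using bij uM subspace_0[OF assms(3)] unfolding bij_betw_def inj_on_def by blast
    \<comment> \<open>Once its entry in \<open>M\<close> is 0, the family is a relation among the
      old summands.\<close>
    then have "\<forall>j<k. u j \<in> W j"
      using u(1) D by (metis fun_upd_other subspace_0)
    then show ?thesis using D u(2) by blast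
  qed
  moreover have "\<forall>j<k. subspace ((W(i := M)) j) \<and> (W(i := M)) j \<subseteq> V"
    using D assms(3,4) by simp
  ultimately show ?thesis unfolding internal_direct_sum_iff[OF assms(1)] by blast
qed

section \<open>Replacing summands one after another\<close>

text \<open>Transports a family indexed by the second decomposition to the positions of the first:
  entry \<open>j\<close> moves to \<open>g j\<close>, and unoccupied positions receive 0.\<close>

lemma sum_reindexed_component:
  fixes k m :: nat
  assumes "inj_on g {..<m}" "g ` {..<m} \<subseteq> {..<k}"
  shows "(\<Sum>i<k. if i \<in> g ` {..<m} then h (inv_into {..<m} g i) else 0) = (\<Sum>j<m. h j)"
proof -
  have "(\<Sum>i<k. if i \<in> g ` {..<m} then h (inv_into {..<m} g i) else 0)
      = (\<Sum>i\<in>g ` {..<m}. h (inv_into {..<m} g i))"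
    using assms(2) by (simp add: sum.If_cases Int_absorb1)
  also have "\<dots> = (\<Sum>j<m. h j)"
    using assms(1) by (simp add: sum.reindex)
  finally show ?thesis .
qed

text \<open>\<open>W\<close> is the decomposition after \<open>m\<close> exchanges and
  \<open>g j\<close> the position where \<open>U' j\<close> has replaced \<open>U (g j)\<close>.
  That unoccupied positions still hold their original summand is carried along, because the next
  isomorphism has to involve some \<open>U i\<close>.\<close>

lemma exchange_prefix:
  fixes V :: "'a::real_inner set"
  assumes rot: "rotational_rep V \<delta> \<epsilon>"
    and dec: "irreducible_decomposition k U V \<delta> \<epsilon>"
    and dec': "irreducible_decomposition l U' V \<delta> \<epsilon>"
    and "m \<le> l"
  shows "\<exists>g W. inj_on g {..<m} \<and> g ` {..<m} \<subseteq> {..<k} \<and> internal_direct_sum k W V \<and>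
    (\<forall>j<m. W (g j) = U' j \<and> rot_isomorphic (U (g j)) \<delta> \<epsilon> (U' j) \<delta> \<epsilon>) \<and>
    (\<forall>i<k. i \<notin> g ` {..<m} \<longrightarrow> W i = U i)"
  using \<open>m \<le> l\<close>
proof (induction m)
  case 0
  show ?case using dec by (intro exI[of _ id] exI[of _ U]) (simp add: irreducible_decomposition_def)
next
  case (Suc m)
  have sV: "subspace V" and lin: "linear_between V V \<delta>" "linear_between V V \<epsilon>"
    using rot by (auto simp: rotational_rep_def euclidean_def rotation_in_def)
  have U: "subrep (U i) V \<delta> \<epsilon>" "irreducible_rep (U i) \<delta> \<epsilon>" if "i < k" for i
    using dec that by (auto simp: irreducible_decomposition_def)
  have U': "subrep (U' j) V \<delta> \<epsilon>" "irreducible_rep (U' j) \<delta> \<epsilon>" if "j < l" for j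
    using dec' that by (auto simp: irreducible_decomposition_def)
  have D': "internal_direct_sum l U' V" using dec' by (simp add: irreducible_decomposition_def)
  have "m < l" using Suc.prems by simp
  obtain g W where g: "inj_on g {..<m}" "g ` {..<m} \<subseteq> {..<k}"
    and D: "internal_direct_sum k W V"
    and Wg: "\<And>j. j < m \<Longrightarrow> W (g j) = U' j"
    and iso: "\<And>j. j < m \<Longrightarrow> rot_isomorphic (U (g j)) \<delta> \<epsilon> (U' j) \<delta> \<epsilon>"
    and WU: "\<And>i. i < k \<Longrightarrow> i \<notin> g ` {..<m} \<Longrightarrow> W i = U i"
    using Suc by auto
  have W: "subrep (W i) V \<delta> \<epsilon>" if "i < k" for i
    using that Wg WU U U' \<open>m < l\<close> by (cases "i \<in> g ` {..<m}") auto
  obtain p where p: "\<And>i v. i < k \<Longrightarrow> v \<in> V \<Longrightarrow> p i v \<in> W i"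
      "\<And>v. v \<in> V \<Longrightarrow> (\<Sum>i<k. p i v) = v"
      "\<And>u v i. v \<in> V \<Longrightarrow> (\<And>j. j < k \<Longrightarrow> u j \<in> W j) \<Longrightarrow> (\<Sum>j<k. u j) = v \<Longrightarrow> i < k \<Longrightarrow> p i v = u i"
    using direct_sum_components[OF sV D] by blast
  have M: "subspace (U' m)" "U' m \<subseteq> V" using U'(1)[OF \<open>m < l\<close>] by (auto simp: subrep_def)
  obtain x where x: "x \<in> U' m" "x \<noteq> 0"
    using U'(2)[OF \<open>m < l\<close>] subspace_0[OF M(1)] unfolding irreducible_rep_def by blast
  then have xV: "x \<in> V" using M(2) by blast
  \<comment> \<open>Otherwise \<open>x\<close> would be a sum of vectors from the
    \<open>U' j\<close> with \<open>j < m\<close>, against the independence of the second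
    decomposition.\<close>
  have "\<exists>i<k. i \<notin> g ` {..<m} \<and> p i x \<noteq> 0"
  proof (rule ccontr)
    assume "\<not> ?thesis"
    then have "(\<Sum>i<k. p i x) =
        (\<Sum>i<k. if i \<in> g ` {..<m} then p (g (inv_into {..<m} g i)) x else 0)"
      using g(1) by (intro sum.cong) auto
    then have eq: "x = (\<Sum>j<m. p (g j) x)"
      using sum_reindexed_component[OF g, of "\<lambda>j. p (g j) x"] p(2)[OF xV] by simp
    \<comment> \<open>The forbidden relation: the components of \<open>x\<close> at the first
      \<open>m\<close> indices, balanced by \<open>- x\<close> at index \<open>m\<close>.\<close>
    define u where "u j = (if j < m then p (g j) x else if j = m then - x else 0)" for j
    have "u j \<in> U' j" if "j < l" for j
      using that p(1)[of "g j" x] Wg xV g(2) x(1) M U'(1)[OF that]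
      by (auto simp: u_def subspace_neg subrep_def subspace_0)
    moreover have "(\<Sum>j<l. u j) = (\<Sum>j<Suc m. u j)"
      using \<open>m < l\<close> by (intro sum.mono_neutral_right) (auto simp: u_def)
    then have "(\<Sum>j<l. u j) = 0" using eq by (simp add: u_def)
    ultimately have "u m = 0"
      using D' \<open>m < l\<close> unfolding internal_direct_sum_iff[OF sV] by blast
    then show False using x by (simp add: u_def)
  qed
  then obtain i where i: "i < k" "i \<notin> g ` {..<m}" "p i x \<noteq> 0" by blast
  have Wi: "W i = U i" using WU i by blast
  have "rep_hom V \<delta> \<epsilon> (W i) \<delta> \<epsilon> (p i)"
    by (rule component_rep_hom[where p = p and W = W, OF lin sV]) (fact W p i(1))+
  \<comment> \<open>Restricted to \<open>U' m\<close>, the projection is a homomorphism between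
    irreducibles that is nonzero at \<open>x\<close>, so Schur's lemma applies.\<close>
  then have hom: "rep_hom (U' m) \<delta> \<epsilon> (U i) \<delta> \<epsilon> (p i)"
    using M Wi unfolding rep_hom_def linear_between_def by (auto simp: subset_iff)
  have r: "rotational_rep (U' m) \<delta> \<epsilon>" "rotational_rep (U i) \<delta> \<epsilon>"
    using rotational_subrep[OF rot] U U' i \<open>m < l\<close> by auto
  have bij: "bij_betw (p i) (U' m) (U i)"
    by (rule schur_bij_betw[OF r _ _ hom x(1) i(3)]) (use U U' i \<open>m < l\<close> in auto)
  have "rot_isomorphic (U i) \<delta> \<epsilon> (U' m) \<delta> \<epsilon>"
    using rot_isomorphic_sym irreducible_hom_rot_isomorphic[OF r _ hom bij] U' \<open>m < l\<close> by blast
  moreover have "internal_direct_sum k (W(i := U' m)) V"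
    by (rule internal_direct_sum_exchange[where p = p, OF sV D M i(1)])
      (fact p bij[folded Wi])+
  moreover have "(g(m := i)) ` {..<Suc m} = insert i (g ` {..<m})"
    by (auto simp: lessThan_Suc)
  moreover have "inj_on (g(m := i)) {..<Suc m}"
    using g(1) i(2) by (auto simp: lessThan_Suc inj_on_def)
  moreover have "\<forall>j<Suc m. (W(i := U' m)) ((g(m := i)) j) = U' j"
    using i(2) Wg by (auto simp: less_Suc_eq)
  moreover have "rot_isomorphic (U ((g(m := i)) j)) \<delta> \<epsilon> (U' j) \<delta> \<epsilon>" if "j < Suc m" for j
    using that iso \<open>rot_isomorphic (U i) \<delta> \<epsilon> (U' m) \<delta> \<epsilon>\<close> by (auto simp: less_Suc_eq)
  moreover have "\<forall>n<k. n \<notin> insert i (g ` {..<m}) \<longrightarrow> (W(i := U' m)) n = U n"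
    using WU by simp
  moreover have "insert i (g ` {..<m}) \<subseteq> {..<k}" using g(2) i(1) by simp
  ultimately show ?case by metis
qed

section \<open>Counting the summands and building the permutation\<close>

theorem proposition1p2:
  fixes V :: "'a::real_inner set"
    and \<delta> \<epsilon> :: "'a \<Rightarrow> 'a"
    and k l :: nat
    and U U' :: "nat \<Rightarrow> 'a set"
  assumes "rotational_rep V \<delta> \<epsilon>"
    and "irreducible_decomposition k U V \<delta> \<epsilon>"
    and "irreducible_decomposition l U' V \<delta> \<epsilon>"
  shows "k = l \<and>
    (\<exists>f. f permutes {..<k} \<and>
      (\<forall>i<k. rot_isomorphic (U (f i)) \<delta> \<epsilon> (U' i) \<delta> \<epsilon>))"
proof -
  have sV: "subspace V" using assms(1) by (simp add: rotational_rep_def euclidean_def)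
  obtain g W where g: "inj_on g {..<l}" "g ` {..<l} \<subseteq> {..<k}"
    and D: "internal_direct_sum k W V"
    and Wg: "\<And>j. j < l \<Longrightarrow> W (g j) = U' j"
    and iso: "\<And>j. j < l \<Longrightarrow> rot_isomorphic (U (g j)) \<delta> \<epsilon> (U' j) \<delta> \<epsilon>"
    and WU: "\<And>i. i < k \<Longrightarrow> i \<notin> g ` {..<l} \<Longrightarrow> W i = U i"
    using exchange_prefix[OF assms order_refl] by blast
  note DW = D[unfolded internal_direct_sum_iff[OF sV]]
  \<comment> \<open>An unoccupied position would still hold a nonzero \<open>U i\<close>, although
    the \<open>U' j\<close> at the occupied positions already span \<open>V\<close>; this is a
    nontrivial relation in \<open>W\<close>.\<close>
  have "i \<in> g ` {..<l}" if "i < k" for i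
  proof (rule ccontr)
    assume i: "i \<notin> g ` {..<l}"
    have "U i \<noteq> {0}" "subspace (U i)" "U i \<subseteq> V"
      using assms(2) that
      by (auto simp: irreducible_decomposition_def irreducible_rep_def subrep_def)
    then obtain x where x: "x \<in> U i" "x \<noteq> 0" "x \<in> V" using subspace_0 by blast
    obtain h where h: "\<And>j. j < l \<Longrightarrow> h j \<in> U' j" "(\<Sum>j<l. h j) = x"
      using assms(3) x(3)
      unfolding irreducible_decomposition_def internal_direct_sum_iff[OF sV] by blast
    \<comment> \<open>\<open>w\<close> places the expansion of \<open>x\<close> along the
      \<open>U' j\<close> at the positions \<open>g j\<close>; \<open>u\<close> then subtracts
      \<open>x\<close> at position \<open>i\<close>, where \<open>w\<close> is 0.\<close>
    define w where "w n = (if n \<in> g ` {..<l} then h (inv_into {..<l} g n) else 0)" for n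
    define u where "u n = w n - (if n = i then x else 0)" for n
    have "w n \<in> W n" if "n < k" for n
    proof (cases "n \<in> g ` {..<l}")
      case True
      then obtain j where "j < l" "n = g j" by auto
      then show ?thesis using g(1) h(1) Wg by (simp add: w_def)
    qed (use DW that in \<open>simp add: w_def subspace_0\<close>)
    then have "\<forall>n<k. u n \<in> W n"
      using DW x(1) WU[OF \<open>i < k\<close> i] by (auto simp: u_def intro!: subspace_diff)
    moreover have "(\<Sum>n<k. w n) = x"
      unfolding w_def using sum_reindexed_component[OF g, of h] h(2) by simp
    then have "(\<Sum>n<k. u n) = 0" using \<open>i < k\<close> by (simp add: u_def sum_subtractf)
    ultimately have "u i = 0" using DW \<open>i < k\<close> by blast
    then show False using x(2) i by (simp add: u_def w_def)
  qed
  then have im: "g ` {..<l} = {..<k}" using g(2) by blast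
  then have kl: "k = l" using card_image[OF g(1)] by simp
  \<comment> \<open>A permutation of \<open>{..<k}\<close> must fix all other indices, so
    \<open>g\<close> is continued by the identity.\<close>
  define f where "f i = (if i < k then g i else i)" for i
  have "bij_betw f {..<k} {..<k}"
    using g(1) im kl by (auto simp: bij_betw_def f_def inj_on_def)
  then have "f permutes {..<k}"
    by (intro bij_imp_permutes) (auto simp: f_def)
  then show ?thesis using kl iso by (auto simp: f_def)
qed

end
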